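(* There exist a measurable set $S\subset\mathbb{R}$ of finite Lebesgue measure with periodic gaps and a measurable set $Q\subset\mathbb{R}$ of density zero such that the pair $(S,Q)$ is not strongly annihilating.
   Context: $|\cdot|$ denotes Lebesgue measure on $\mathbb{R}$. The Fourier transform is normalized as $\mathcal{F}f(\xi)=\int_{\mathbb{R}}e^{-2\pi i x\xi}f(x)\,dx$ (extended to $L^2(\mathbb{R})$ as usual). A set $S\subset\mathbb{R}$ has periodic gaps if there are an interval $I$ (of positive length) and a number $T>0$ such that $I+kT\subset S^c=\mathbb{R}\setminus S$ for all $k\in\mathbb{Z}$. A set $Q\subset\mathbb{R}$ is of density zero if $|Q\cap(-r,r)|=o(r)$ as $r\to\infty$. A pair $(S,Q)$ of measurable sets is strongly annihilating if there is a constant $C=C(S,Q)>0$ such that for all $f\in L^2(\mathbb{R})$, $$\|f\|_2^2\le C\left(\|f\|_{L^2(S^c)}^2+\|\mathcal{F}f\|_{L^2(Q^c)}^2\right).$$ *)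

theory Defs
  imports "HOL-Analysis.Analysis" "HOL-Library.Landau_Symbols"
begin

definition L2 :: "(real \<Rightarrow> complex) set" where
  "L2 = {f. f \<in> borel_measurable lebesgue \<and> integrable lebesgue (\<lambda>x. (cmod (f x))\<^sup>2)}"

definition L2norm_on :: "real set \<Rightarrow> (real \<Rightarrow> complex) \<Rightarrow> real" where
  "L2norm_on A f = sqrt (LINT x:A|lebesgue. (cmod (f x))\<^sup>2)"

definition fourier :: "(real \<Rightarrow> complex) \<Rightarrow> real \<Rightarrow> complex" where
  "fourier f \<xi> = (LINT x|lebesgue. exp (- 2 * of_real pi * \<i> * of_real x * of_real \<xi>) * f x)"

(* The extension of the integral transform from L1 \<inter> L2 to L2 by continuity, given by its graph:
   by Plancherel's theorem every f in L2 has such a g, and g is unique up to null sets.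
   By the same theorem the requirement fourier (h n) \<in> L2 is automatic; it is stated so that
   the norms below are evidently those of square-integrable functions. *)
definition has_fourier_L2 :: "(real \<Rightarrow> complex) \<Rightarrow> (real \<Rightarrow> complex) \<Rightarrow> bool" where
  "has_fourier_L2 f g \<longleftrightarrow> f \<in> L2 \<and> g \<in> L2 \<and>
     (\<exists>h :: nat \<Rightarrow> real \<Rightarrow> complex.
        (\<forall>n. integrable lebesgue (h n) \<and> h n \<in> L2 \<and> fourier (h n) \<in> L2) \<and>
        (\<lambda>n. L2norm_on UNIV (\<lambda>x. h n x - f x)) \<longlonglongrightarrow> 0 \<and>
        (\<lambda>n. L2norm_on UNIV (\<lambda>\<xi>. fourier (h n) \<xi> - g \<xi>)) \<longlonglongrightarrow> 0)"

definition periodic_gaps :: "real set \<Rightarrow> bool" where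
  "periodic_gaps S \<longleftrightarrow>
     (\<exists>I T. is_interval I \<and> emeasure lebesgue I > 0 \<and> T > 0 \<and>
        (\<forall>k::int. (\<lambda>x. x + of_int k * T) ` I \<subseteq> - S))"

definition density_zero :: "real set \<Rightarrow> bool" where
  "density_zero Q \<longleftrightarrow> (\<lambda>r. measure lebesgue (Q \<inter> {-r<..<r})) \<in> o[at_top](\<lambda>r::real. r)"

(* All norms involved are finite, since has_fourier_L2 f g places f and g in L2.
   The function g ranges over the representatives of the Fourier transform of f. *)
definition strongly_annihilating :: "real set \<Rightarrow> real set \<Rightarrow> bool" where
  "strongly_annihilating S Q \<longleftrightarrow>
     (\<exists>C>0. \<forall>f\<in>L2. \<forall>g. has_fourier_L2 f g \<longrightarrow>
        (L2norm_on UNIV f)\<^sup>2 \<le> C * ((L2norm_on (- S) f)\<^sup>2 + (L2norm_on (- Q) g)\<^sup>2))"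

end

theory Submission
  imports Defs "HOL-Probability.Sinc_Integral" "HOL-Real_Asymp.Real_Asymp"
begin

text \<open>
  A set of density zero may contain arbitrarily long intervals, provided that these lie far out.
  This alone defeats the estimate, even for the bounded set \<open>S = [0,1]\<close>: fix one function
  supported in \<open>S\<close>, the indicator \<open>\<phi>\<close> of \<open>[0,1]\<close>. Modulation by
  \<open>e\<^sup>2\<^sup>\<pi>\<^sup>i\<^sup>M\<^sup>x\<close> changes neither the support nor the norm, and translates the
  Fourier transform by \<open>M\<close>. If \<open>Q\<close> contains the intervals \<open>(M\<^sub>n - n, M\<^sub>n + n)\<close>, the
  energy of the transform of the \<open>n\<close>-th modulation outside \<open>Q\<close> is at most the energy
  of \<open>\<F>\<phi>\<close> outside \<open>(-n, n)\<close>, a tail of a convergent integral. So no constant \<open>C\<close> works.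

  The choice \<open>M\<^sub>n = n\<^sup>4 + n\<close> gives density zero: fewer than about \<open>r\<^sup>1\<^sup>/\<^sup>4\<close> of the
  intervals meet \<open>(-r, r)\<close>, and each of them has length at most \<open>2 r\<^sup>1\<^sup>/\<^sup>4\<close>. A bounded
  set has periodic gaps for any sufficiently large period. The transform \<open>\<F>\<phi>\<close> is explicit,
  so its square integrability, usually read off from Plancherel's theorem, follows here from
  decay of order \<open>1/\<bar>\<xi>\<bar>\<close>.
\<close>

definition sparse_long_intervals :: "real set" where
  "sparse_long_intervals = (\<Union>n::nat. {real n ^ 4 <..< real n ^ 4 + 2 * real n})"

lemma sparse_long_intervals_borel [measurable]: "sparse_long_intervals \<in> sets borel"
  unfolding sparse_long_intervals_def by measurable

text \<open>
  An interval meeting \<open>(-r, r)\<close> has index below \<open>r\<^sup>1\<^sup>/\<^sup>4\<close>, and the lengths \<open>2n\<close> of the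
  first \<open>m\<close> intervals add up to \<open>m (m + 1)\<close>.
\<close>
lemma measure_sparse_long_intervals_le:
  fixes r :: real
  assumes "r \<ge> 1"
  shows "measure lebesgue (sparse_long_intervals \<inter> {-r<..<r}) \<le> 2 * sqrt r"
proof -
  define s where "s = sqrt (sqrt r)"
  define m where "m = nat \<lfloor>s\<rfloor>"
  have s: "s \<ge> 1" "s ^ 2 = sqrt r" "s ^ 4 = r"
  proof -
    show "s \<ge> 1" and "s ^ 2 = sqrt r"
      using assms by (simp_all add: s_def)
    then show "s ^ 4 = r"
      using assms power_mult[of s 2 2] by simp
  qed
  let ?J = "\<lambda>n. {real n ^ 4 <..< real n ^ 4 + 2 * real n}"
  have "sparse_long_intervals \<inter> {-r<..<r} \<subseteq> (\<Union>n\<in>{..m}. ?J n)"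
  proof
    fix x assume "x \<in> sparse_long_intervals \<inter> {-r<..<r}"
    then obtain n where n: "x \<in> ?J n" "x < r"
      by (auto simp: sparse_long_intervals_def)
    then have "real n ^ 4 < s ^ 4"
      using s by simp
    then have "real n < s"
      using s by (meson power_less_imp_less_base order_trans zero_le_one)
    then have "n \<le> m"
      by (simp add: m_def le_nat_floor)
    then show "x \<in> (\<Union>n\<in>{..m}. ?J n)"
      using n by blast
  qed
  moreover have "(\<Union>n\<in>{..m}. ?J n) \<in> lmeasurable"
    by (intro fmeasurable.finite_UN) auto
  ultimately have "measure lebesgue (sparse_long_intervals \<inter> {-r<..<r})
      \<le> measure lebesgue (\<Union>n\<in>{..m}. ?J n)"
    by (intro measure_mono_fmeasurable) auto
  also have "\<dots> \<le> (\<Sum>n\<le>m. measure lebesgue (?J n))"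
    by (intro measure_UNION_le) auto
  also have "\<dots> = (\<Sum>n\<le>m. 2 * real n)"
    by simp
  also have "\<dots> = real m * (real m + 1)"
    by (induction m) (auto simp: algebra_simps)
  also have "\<dots> \<le> s * (s + s)"
  proof -
    have "real m \<le> s"
      using s by (simp add: m_def)
    then show ?thesis
      using s by (intro mult_mono) auto
  qed
  also have "\<dots> = 2 * sqrt r"
    using s by (simp add: power2_eq_square)
  finally show ?thesis .
qed

lemma density_zero_sparse_long_intervals: "density_zero sparse_long_intervals"
proof -
  have "(\<lambda>r. measure lebesgue (sparse_long_intervals \<inter> {-r<..<r})) \<in> O[at_top](\<lambda>r. sqrt r)"
    by (intro bigoI[of _ 2] eventually_mono[OF eventually_ge_at_top[of 1]])
       (use measure_sparse_long_intervals_le in auto)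
  also have "(\<lambda>r::real. sqrt r) \<in> o[at_top](\<lambda>r. r)"
    by real_asymp
  finally show ?thesis
    by (simp add: density_zero_def)
qed

lemma periodic_gaps_unit_interval: "periodic_gaps {0..1}"
  unfolding periodic_gaps_def
proof (intro exI conjI allI)
  show "(\<lambda>x. x + of_int k * 3) ` {3/2<..<5/2} \<subseteq> - {0..1::real}" for k
  proof -
    have "k \<ge> 0 \<or> k \<le> -1"
      by linarith
    then have "real_of_int k \<ge> 0 \<or> real_of_int k \<le> -1"
      by linarith
    then show ?thesis
      by auto
  qed
qed auto

definition modulated_indicator :: "real \<Rightarrow> real \<Rightarrow> complex" where
  "modulated_indicator M x = indicator {0..1} x * exp (2 * of_real pi * \<i> * of_real (M * x))"

text \<open>
  The Fourier transform of the indicator of \<open>[0,1]\<close>, with its value \<open>1\<close> at the removable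
  singularity.
\<close>
definition unit_interval_transform :: "real \<Rightarrow> complex" where
  "unit_interval_transform t =
     (if t = 0 then 1 else (1 - exp (- 2 * of_real pi * \<i> * of_real t)) / (2 * of_real pi * \<i> * of_real t))"

lemma unit_interval_transform_measurable [measurable]:
  "unit_interval_transform \<in> borel_measurable borel"
  unfolding unit_interval_transform_def by measurable

lemma modulated_indicator_measurable [measurable]:
  "modulated_indicator M \<in> borel_measurable borel"
  unfolding modulated_indicator_def by measurable

lemma norm_modulated_indicator: "cmod (modulated_indicator M x) = indicator {0..1} x"
  by (simp add: modulated_indicator_def norm_mult indicator_def)

lemma integrable_indicator_unit: "integrable lebesgue (indicator {0..1::real} :: real \<Rightarrow> real)"
  by (intro integrable_real_indicator) auto

lemma integrable_modulated_indicator: "integrable lebesgue (modulated_indicator M)"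
  by (rule Bochner_Integration.integrable_bound[OF integrable_indicator_unit])
     (auto simp: norm_modulated_indicator intro!: measurable_completion)

lemma modulated_indicator_L2: "modulated_indicator M \<in> L2"
proof -
  have "(\<lambda>x. (cmod (modulated_indicator M x))\<^sup>2) = indicator {0..1}"
    by (auto simp: norm_modulated_indicator indicator_def)
  then show ?thesis
    using integrable_indicator_unit by (simp add: L2_def measurable_completion)
qed

lemma fourier_modulated_indicator:
  "fourier (modulated_indicator M) \<xi> = unit_interval_transform (\<xi> - M)"
proof -
  define c where "c = - (2 * of_real pi * \<i> * of_real (\<xi> - M))"
  have "exp (- 2 * of_real pi * \<i> * of_real x * of_real \<xi>) * modulated_indicator M x
      = indicator {0..1} x *\<^sub>R exp (of_real x * c)" for x
    by (auto simp: modulated_indicator_def c_def indicator_def algebra_simps simp flip: exp_add)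
  then have "fourier (modulated_indicator M) \<xi> =
      (LINT x|lebesgue. indicator {0..1} x *\<^sub>R exp (of_real x * c))"
    by (simp add: fourier_def)
  also have "\<dots> = (LINT x|lborel. indicator {0..1} x *\<^sub>R exp (of_real x * c))"
    by (intro integral_completion) measurable
  also have "\<dots> = unit_interval_transform (\<xi> - M)"
  proof (cases "\<xi> = M")
    case True
    then show ?thesis
      by (simp add: c_def unit_interval_transform_def)
  next
    case False
    then have [simp]: "c \<noteq> 0"
      by (simp add: c_def)
    have "(LINT x|lborel. indicator {0..1} x *\<^sub>R exp (of_real x * c))
        = exp (of_real 1 * c) / c - exp (of_real 0 * c) / c"
    proof (rule integral_FTC_atLeastAtMost)
      fix x :: real
      have "((\<lambda>z. exp (z * c) / c) has_field_derivative exp (of_real x * c)) (at (of_real x))"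
        by (auto intro!: derivative_eq_intros)
      then show "((\<lambda>x. exp (of_real x * c) / c) has_vector_derivative exp (of_real x * c))
          (at x within {0..1})"
        using has_vector_derivative_at_within has_vector_derivative_real_field by blast
    qed (auto intro!: continuous_intros)
    also have "\<dots> = (1 - exp c) / - c"
      by (simp add: diff_divide_distrib)
    also have "\<dots> = unit_interval_transform (\<xi> - M)"
      using False by (simp add: unit_interval_transform_def c_def)
    finally show ?thesis .
  qed
  finally show ?thesis .
qed

text \<open>
  Bounding the Fourier integral, rather than the quotient, avoids estimating
  \<open>1 - e\<^sup>-\<^sup>2\<^sup>\<pi>\<^sup>i\<^sup>t\<close> near the removable singularity.
\<close>
lemma norm_unit_interval_transform_le_1: "cmod (unit_interval_transform t) \<le> 1"
proof -
  have "cmod (unit_interval_transform t) = cmod (fourier (modulated_indicator 0) t)"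
    by (simp add: fourier_modulated_indicator)
  also have "\<dots> \<le> (LINT x|lebesgue. indicator {0..1::real} x)"
    unfolding fourier_def
    by (rule order_trans[OF integral_norm_bound]) (simp add: norm_mult norm_modulated_indicator)
  finally show ?thesis
    by simp
qed

lemma norm_unit_interval_transform_decay: "cmod (unit_interval_transform t) * \<bar>t\<bar> \<le> 1"
proof (cases "t = 0")
  case False
  have "cmod (1 - exp (- 2 * of_real pi * \<i> * of_real t)) \<le> 1 + 1"
    by (rule norm_triangle_le_diff) simp
  then have "cmod (unit_interval_transform t) * \<bar>t\<bar> \<le> 1 / pi"
    using False by (simp add: unit_interval_transform_def norm_divide norm_mult field_simps)
  also have "\<dots> \<le> 1"
    using pi_gt3 by simp
  finally show ?thesis .
qed simp

lemma integrable_unit_interval_transform_sq: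
  "integrable lborel (\<lambda>t. (cmod (unit_interval_transform t))\<^sup>2)"
proof (rule Bochner_Integration.integrable_bound)
  show "integrable lborel (\<lambda>t::real. 2 * inverse (1 + t\<^sup>2))"
    using integrable_inverse_1_plus_square by (simp add: set_integrable_def)
  have "(cmod (unit_interval_transform t))\<^sup>2 \<le> 2 * inverse (1 + t\<^sup>2)" for t
  proof -
    let ?a = "cmod (unit_interval_transform t)"
    have "?a\<^sup>2 \<le> 1" "(?a * \<bar>t\<bar>)\<^sup>2 \<le> 1"
      using norm_unit_interval_transform_le_1 norm_unit_interval_transform_decay
      by (simp_all add: power_le_one)
    then have "?a\<^sup>2 * (1 + t\<^sup>2) \<le> 2"
      by (simp add: power_mult_distrib distrib_left)
    then show ?thesis
      by (simp add: field_simps add_pos_nonneg)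
  qed
  then show "AE t in lborel. norm ((cmod (unit_interval_transform t))\<^sup>2) \<le> norm (2 * inverse (1 + t\<^sup>2))"
    by simp
qed measurable

lemma fourier_modulated_indicator_L2: "fourier (modulated_indicator M) \<in> L2"
proof -
  have "integrable lborel (\<lambda>\<xi>. (cmod (unit_interval_transform (\<xi> - M)))\<^sup>2)"
    using lborel_integrable_real_affine[OF integrable_unit_interval_transform_sq, of 1 "-M"] by simp
  then show ?thesis
    unfolding L2_def fourier_modulated_indicator[abs_def]
    by (simp add: integrable_completion measurable_completion)
qed

text \<open>
  The constant sequence serves as the approximating sequence, so on such functions the \<open>L\<^sup>2\<close>
  transform agrees with the integral.
\<close>
lemma has_fourier_L2_fourier:
  assumes "integrable lebesgue f" "f \<in> L2" "fourier f \<in> L2"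
  shows "has_fourier_L2 f (fourier f)"
  unfolding has_fourier_L2_def
  using assms by (intro conjI exI[of _ "\<lambda>_. f"]) (auto simp: L2norm_on_def)

lemma integral_tails_tendsto_0:
  fixes h :: "real \<Rightarrow> real"
  assumes "integrable lborel h"
  shows "(\<lambda>n. LINT t|lborel. indicator {t. real n \<le> \<bar>t\<bar>} t * h t) \<longlonglongrightarrow> 0"
proof -
  note [measurable] = borel_measurable_integrable[OF assms]
  have "(\<lambda>n. LINT t|lborel. indicator {t. real n \<le> \<bar>t\<bar>} t * h t)
      \<longlonglongrightarrow> (LINT t|(lborel::real measure). 0)"
  proof (rule integral_dominated_convergence)
    show "integrable lborel (\<lambda>t. norm (h t))"
      using assms by simp
    show "AE t in lborel. (\<lambda>n. indicator {t. real n \<le> \<bar>t\<bar>} t * h t) \<longlonglongrightarrow> 0"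
    proof (rule AE_I2)
      fix t :: real
      have "eventually (\<lambda>n. real n > \<bar>t\<bar>) sequentially"
        using filterlim_real_sequentially by (auto simp: filterlim_at_top_dense)
      then show "(\<lambda>n. indicator {t. real n \<le> \<bar>t\<bar>} t * h t) \<longlonglongrightarrow> 0"
        by (intro tendsto_eventually) (auto elim: eventually_mono)
    qed
  qed (auto simp: indicator_def)
  then show ?thesis
    by simp
qed

text \<open>
  The interval of index \<open>n\<close> is centred at \<open>n\<^sup>4 + n\<close> and has half-length \<open>n\<close>, so translating
  its complement back to the origin leaves only the tail \<open>\<bar>t\<bar> \<ge> n\<close>.
\<close>
lemma energy_outside_le_tail:
  "(L2norm_on (- sparse_long_intervals) (fourier (modulated_indicator (real n ^ 4 + real n))))\<^sup>2
     \<le> (LINT t|lborel. indicator {t. real n \<le> \<bar>t\<bar>} t * (cmod (unit_interval_transform t))\<^sup>2)"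
proof -
  define M where "M = real n ^ 4 + real n"
  define h where "h = (\<lambda>t. (cmod (unit_interval_transform t))\<^sup>2)"
  define w where "w = (\<lambda>t. indicator {t. real n \<le> \<bar>t\<bar>} t * h t)"
  have h: "integrable lborel h" and h_nonneg: "\<And>t. h t \<ge> 0"
    using integrable_unit_interval_transform_sq by (simp_all add: h_def)
  note [measurable] = borel_measurable_integrable[OF h]
  have w: "integrable lborel w"
    unfolding w_def
    by (rule Bochner_Integration.integrable_bound[OF h]) (auto simp: indicator_def)
  have "(L2norm_on (- sparse_long_intervals) (fourier (modulated_indicator M)))\<^sup>2
      = (LINT \<xi>|lebesgue. indicator (- sparse_long_intervals) \<xi> *\<^sub>R h (\<xi> - M))"
    using h_nonneg
    by (simp add: L2norm_on_def set_lebesgue_integral_def fourier_modulated_indicator h_def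
        integral_nonneg_AE)
  also have "\<dots> = (LINT \<xi>|lborel. indicator (- sparse_long_intervals) \<xi> *\<^sub>R h (\<xi> - M))"
    by (intro integral_completion) measurable
  also have "\<dots> \<le> (LINT \<xi>|lborel. w (\<xi> - M))"
  proof (rule integral_mono')
    show "integrable lborel (\<lambda>\<xi>. w (\<xi> - M))"
      using lborel_integrable_real_affine[OF w, of 1 "-M"] by simp
    show "indicator (- sparse_long_intervals) \<xi> *\<^sub>R h (\<xi> - M) \<le> w (\<xi> - M)" for \<xi>
    proof (cases "real n \<le> \<bar>\<xi> - M\<bar>")
      case False
      then have "\<xi> \<in> {real n ^ 4 <..< real n ^ 4 + 2 * real n}"
        by (auto simp: M_def abs_if split: if_splits)
      then have "\<xi> \<in> sparse_long_intervals"
        unfolding sparse_long_intervals_def by blast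
      then show ?thesis
        using h_nonneg by (simp add: w_def)
    qed (use h_nonneg in \<open>auto simp: w_def indicator_def\<close>)
    show "w (\<xi> - M) \<ge> 0" for \<xi>
      using h_nonneg by (simp add: w_def)
  qed
  also have "\<dots> = (LINT t|lborel. w t)"
    using lborel_integral_real_affine[of 1 w "-M"] by simp
  finally show ?thesis
    by (simp add: M_def w_def h_def)
qed

lemma not_strongly_annihilating_unit_interval:
  "\<not> strongly_annihilating {0..1} sparse_long_intervals"
proof
  assume "strongly_annihilating {0..1} sparse_long_intervals"
  then obtain C where "C > 0" and C: "\<And>f g. f \<in> L2 \<Longrightarrow> has_fourier_L2 f g \<Longrightarrow>
      (L2norm_on UNIV f)\<^sup>2 \<le>
        C * ((L2norm_on (- {0..1}) f)\<^sup>2 + (L2norm_on (- sparse_long_intervals) g)\<^sup>2)"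
    unfolding strongly_annihilating_def by blast
  define tail where "tail = (\<lambda>n::nat. LINT t|lborel.
      indicator {t. real n \<le> \<bar>t\<bar>} t * (cmod (unit_interval_transform t))\<^sup>2)"
  have "1 \<le> C * tail n" for n
  proof -
    let ?f = "modulated_indicator (real n ^ 4 + real n)"
    have sq: "(cmod (?f x))\<^sup>2 = indicator {0..1} x" for x
      by (auto simp: norm_modulated_indicator indicator_def)
    have "L2norm_on UNIV ?f = 1"
      by (simp add: L2norm_on_def set_lebesgue_integral_def sq)
    moreover have "L2norm_on (- {0..1}) ?f = 0"
      by (simp add: L2norm_on_def set_lebesgue_integral_def sq flip: indicator_inter_arith)
    moreover have "has_fourier_L2 ?f (fourier ?f)"
      by (intro has_fourier_L2_fourier integrable_modulated_indicator modulated_indicator_L2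
          fourier_modulated_indicator_L2)
    ultimately have "1 \<le> C * (L2norm_on (- sparse_long_intervals) (fourier ?f))\<^sup>2"
      using C[OF modulated_indicator_L2, of "real n ^ 4 + real n" "fourier ?f"] by simp
    also have "\<dots> \<le> C * tail n"
      unfolding tail_def using \<open>C > 0\<close> energy_outside_le_tail by (intro mult_left_mono) auto
    finally show ?thesis .
  qed
  moreover have "(\<lambda>n. C * tail n) \<longlonglongrightarrow> C * 0"
    unfolding tail_def
    by (intro tendsto_mult_left integral_tails_tendsto_0 integrable_unit_interval_transform_sq)
  ultimately have "1 \<le> C * 0"
    by (intro LIMSEQ_le_const) auto
  then show False
    by simp
qed

theorem theorem2:
  "\<exists>S Q :: real set. S \<in> sets lebesgue \<and> emeasure lebesgue S < \<infinity> \<and> periodic_gaps S \<and>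
     Q \<in> sets lebesgue \<and> density_zero Q \<and> \<not> strongly_annihilating S Q"
proof (intro exI conjI)
  show "emeasure lebesgue {0..1::real} < \<infinity>"
    by simp
  show "sparse_long_intervals \<in> sets lebesgue"
    by simp
qed (use periodic_gaps_unit_interval density_zero_sparse_long_intervals
      not_strongly_annihilating_unit_interval in auto)

end
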